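(* Let $W(x)=|x|^a$ and $V(x)=|x|^b$, $a>0$, $b>0$, and let $\xi_k$, $k\ge1$, be random variables from $D_{V,W}(\Omega)$ with prenorm $\|\cdot\|$. Then the series $\sum_{k=1}^\infty\xi_k$ converges in probability when the series $$\mu=\sum_{k=1}^\infty\|\xi_k\|^{\frac{2a}{ab+1}}$$ converges, and for $x\ge\mu$ $$P\Big\{\Big|\sum_{k=1}^\infty\xi_k\Big|>x\Big\}\le\frac1{x^{ab}}\left(\sum_{k=1}^\infty\|\xi_k\|^{\frac{2a}{ab+1}}\right)^{ab+1};$$ that is, $\sum_{k=1}^\infty\xi_k$ belongs to the space $D_{V,W}(\Omega)$ and $$\Big\|\sum_{k=1}^\infty\xi_k\Big\|\le\left(\sum_{k=1}^\infty\|\xi_k\|^{\frac{2a}{ab+1}}\right)^{\frac{ab+1}{2a}}.$$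
   Context: For these $V,W$, $D_{V,W}(\Omega)$ is the space of random variables $\xi$ with $\sup_{x\ge0}V(x)W^{(-1)}(P\{|\xi|>x\})<\infty$, where $W^{(-1)}(y)=y^{1/a}$ is the inverse of $W$ on $[0,\infty)$, with prenorm $\|\xi\|=\big(\sup_{x>0}V(x)W^{(-1)}(P\{|\xi|>x\})\big)^{1/2}=\big(\sup_{x>0}x^b(P\{|\xi|>x\})^{1/a}\big)^{1/2}$. *)

theory Defs
  imports "HOL-Probability.Probability"
begin

definition tail_prob :: "'w measure \<Rightarrow> ('w \<Rightarrow> real) \<Rightarrow> real \<Rightarrow> real" where
  "tail_prob M X x = measure M {\<omega> \<in> space M. \<bar>X \<omega>\<bar> > x}"

text \<open>The inverse of W is taken on the half-line \<open>{0..}\<close> only, since W is typically even on the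
  whole line.\<close>

definition D_space :: "'w measure \<Rightarrow> (real \<Rightarrow> real) \<Rightarrow> (real \<Rightarrow> real) \<Rightarrow> ('w \<Rightarrow> real) set" where
  "D_space M V W =
     {X \<in> borel_measurable M.
        bdd_above ((\<lambda>x. V x * inv_into {0..} W (tail_prob M X x)) ` {0..})}"

text \<open>A real-valued supremum, meaningful only for members of \<open>D_space M V W\<close>, where it is finite.
  The square root is the form that the prenorm takes for power functions V and W; it is not
  intended for other choices.\<close>

definition D_prenorm :: "'w measure \<Rightarrow> (real \<Rightarrow> real) \<Rightarrow> (real \<Rightarrow> real) \<Rightarrow> ('w \<Rightarrow> real) \<Rightarrow> real" where
  "D_prenorm M V W X =
     sqrt (SUP x\<in>{0<..}. V x * inv_into {0..} W (tail_prob M X x))"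

definition tendsto_in_prob :: "'w measure \<Rightarrow> (nat \<Rightarrow> 'w \<Rightarrow> real) \<Rightarrow> ('w \<Rightarrow> real) \<Rightarrow> bool" where
  "tendsto_in_prob M X Y \<longleftrightarrow>
     (\<forall>n. X n \<in> borel_measurable M) \<and> Y \<in> borel_measurable M \<and>
     (\<forall>\<epsilon>>0. (\<lambda>n. measure M {\<omega> \<in> space M. \<bar>X n \<omega> - Y \<omega>\<bar> > \<epsilon>}) \<longlonglongrightarrow> 0)"

text \<open>\<open>S\<close> is a sum in probability of the series \<open>\<xi> 1 + \<xi> 2 + \<dots>\<close> (the term \<open>\<xi> 0\<close> is not used).\<close>

definition sums_in_prob :: "'w measure \<Rightarrow> (nat \<Rightarrow> 'w \<Rightarrow> real) \<Rightarrow> ('w \<Rightarrow> real) \<Rightarrow> bool" where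
  "sums_in_prob M \<xi> S \<longleftrightarrow> tendsto_in_prob M (\<lambda>n \<omega>. \<Sum>k=1..n. \<xi> k \<omega>) S"

end

theory Submission
  imports Defs
begin

text \<open>
  Put \<open>p = a * b\<close>. Unfolding the prenorm for power functions, \<open>\<parallel>\<xi>\<parallel> powr (2 * a)\<close> is the
  smallest constant \<open>C\<close> with \<open>P(\<bar>\<xi>\<bar> > x) \<le> C / x powr p\<close> for all \<open>x > 0\<close>; the space is a weak
  \<open>L\<^sup>p\<close> space (lemmas \<open>tail_prob_le_of_D_space\<close> and \<open>D_space_of_tail_prob_le\<close>).
  In terms of \<open>q\<^sub>k = \<parallel>\<xi>\<^sub>k\<parallel> powr (2 * a / (p + 1))\<close>, the terms of the series \<open>\<mu>\<close>, this reads
  \<open>P(\<bar>\<xi>\<^sub>k\<bar> > x) \<le> q\<^sub>k powr (p + 1) / x powr p\<close>.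

  The level \<open>x\<close> is now distributed over the summands in proportion to the \<open>q\<^sub>k\<close>. If
  \<open>\<bar>\<xi>\<^sub>k\<bar> \<le> x * q\<^sub>k / \<mu>\<close> for all \<open>k\<close>, then the absolute values add up to at most \<open>x\<close>. Hence
  \<open>P(\<Sum>\<bar>\<xi>\<^sub>k\<bar> > x) \<le> \<Sum> P(\<bar>\<xi>\<^sub>k\<bar> > x * q\<^sub>k / \<mu>) \<le> \<Sum> q\<^sub>k * \<mu> powr p / x powr p
   = \<mu> powr (p + 1) / x powr p\<close>.
  The exponent \<open>1 / (p + 1)\<close> in the definition of \<open>q\<^sub>k\<close> is the one that makes every summand
  contribute in proportion to its share of the level. This is lemma
  \<open>prob_abs_partial_sums_exceed\<close>, and everything else follows from it. Letting \<open>x\<close> tend to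
  infinity, the series converges absolutely almost surely; applied to the tails of the series,
  whose \<open>\<mu>\<close> tends to zero, the estimate gives convergence in probability; applied to the partial
  sums it gives a uniform bound, which survives limits in probability.
\<close>

section \<open>Power-weighted spaces as weak Lebesgue spaces\<close>

lemma inv_into_abs_powr:
  fixes a y :: real
  assumes "a > 0" "y \<ge> 0"
  shows "inv_into {0..} (\<lambda>x. \<bar>x\<bar> powr a) y = y powr (1 / a)"
proof (rule inv_into_f_eq)
  show "inj_on (\<lambda>x. \<bar>x\<bar> powr a) {0..}"
    using powr_less_mono2[OF assms(1)] by (intro linorder_inj_onI) fastforce+
qed (use assms in \<open>auto simp: powr_powr\<close>)

lemma tail_prob_nonneg: "tail_prob M X x \<ge> 0"
  by (simp add: tail_prob_def)

lemma D_prenorm_of_D_space: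
  fixes a b :: real
  assumes "a > 0" and X: "X \<in> D_space M (\<lambda>x. \<bar>x\<bar> powr b) (\<lambda>x. \<bar>x\<bar> powr a)"
  shows "D_prenorm M (\<lambda>x. \<bar>x\<bar> powr b) (\<lambda>x. \<bar>x\<bar> powr a) X \<ge> 0"
    and "x > 0 \<Longrightarrow> x powr b * tail_prob M X x powr (1 / a)
           \<le> (D_prenorm M (\<lambda>x. \<bar>x\<bar> powr b) (\<lambda>x. \<bar>x\<bar> powr a) X)\<^sup>2"
proof -
  let ?g = "\<lambda>x. \<bar>x\<bar> powr b * inv_into {0..} (\<lambda>x. \<bar>x\<bar> powr a) (tail_prob M X x)"
  have g: "?g x = \<bar>x\<bar> powr b * tail_prob M X x powr (1 / a)" for x
    using assms(1) by (simp add: inv_into_abs_powr tail_prob_nonneg)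
  have "bdd_above (?g ` {0..})"
    using X by (simp add: D_space_def)
  then have bdd: "bdd_above (?g ` {0<..})"
    by (rule bdd_above_mono) auto
  have le: "?g x \<le> (SUP x\<in>{0<..}. ?g x)" if "x > 0" for x
    by (rule cSUP_upper[OF _ bdd]) (use that in auto)
  have nonneg: "0 \<le> (SUP x\<in>{0<..}. ?g x)"
    using le[of 1] unfolding g by (simp add: order_trans[OF powr_ge_zero])
  then show "D_prenorm M (\<lambda>x. \<bar>x\<bar> powr b) (\<lambda>x. \<bar>x\<bar> powr a) X \<ge> 0"
    by (simp add: D_prenorm_def)
  have "(D_prenorm M (\<lambda>x. \<bar>x\<bar> powr b) (\<lambda>x. \<bar>x\<bar> powr a) X)\<^sup>2 = (SUP x\<in>{0<..}. ?g x)"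
    unfolding D_prenorm_def using nonneg by (rule real_sqrt_pow2)
  then show "x powr b * tail_prob M X x powr (1 / a)
          \<le> (D_prenorm M (\<lambda>x. \<bar>x\<bar> powr b) (\<lambda>x. \<bar>x\<bar> powr a) X)\<^sup>2" if "x > 0"
    using le[OF that] g[of x] that by simp
qed

lemma tail_prob_le_of_D_space:
  fixes a b x :: real
  assumes "a > 0" and X: "X \<in> D_space M (\<lambda>x. \<bar>x\<bar> powr b) (\<lambda>x. \<bar>x\<bar> powr a)" and "x > 0"
  shows "tail_prob M X x
           \<le> D_prenorm M (\<lambda>x. \<bar>x\<bar> powr b) (\<lambda>x. \<bar>x\<bar> powr a) X powr (2 * a) / x powr (a * b)"
proof -
  let ?N = "D_prenorm M (\<lambda>x. \<bar>x\<bar> powr b) (\<lambda>x. \<bar>x\<bar> powr a) X"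
  have N: "?N \<ge> 0"
    using D_prenorm_of_D_space(1)[OF assms(1) X] .
  have "x powr b * tail_prob M X x powr (1 / a) \<le> ?N\<^sup>2"
    using D_prenorm_of_D_space(2)[OF assms(1) X \<open>x > 0\<close>] .
  then have "(x powr b * tail_prob M X x powr (1 / a)) powr a \<le> (?N\<^sup>2) powr a"
    using assms(1) by (intro powr_mono2) auto
  also have "(?N\<^sup>2) powr a = ?N powr (2 * a)"
    using N by (cases "?N = 0") (auto simp: powr_powr simp flip: powr_numeral)
  also have "(x powr b * tail_prob M X x powr (1 / a)) powr a = x powr (a * b) * tail_prob M X x"
    using assms(1) tail_prob_nonneg[of M X x]
    by (simp add: powr_mult powr_powr mult.commute)
  finally show ?thesis
    using \<open>x > 0\<close> by (simp add: field_simps)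
qed

lemma D_space_of_tail_prob_le:
  fixes a b C :: real
  assumes "a > 0" "C \<ge> 0" and X: "X \<in> borel_measurable M"
    and tail: "\<And>x. x > 0 \<Longrightarrow> tail_prob M X x \<le> C / x powr (a * b)"
  shows "X \<in> D_space M (\<lambda>x. \<bar>x\<bar> powr b) (\<lambda>x. \<bar>x\<bar> powr a)"
    and "D_prenorm M (\<lambda>x. \<bar>x\<bar> powr b) (\<lambda>x. \<bar>x\<bar> powr a) X \<le> C powr (1 / (2 * a))"
proof -
  let ?g = "\<lambda>x. \<bar>x\<bar> powr b * inv_into {0..} (\<lambda>x. \<bar>x\<bar> powr a) (tail_prob M X x)"
  have g: "?g x = \<bar>x\<bar> powr b * tail_prob M X x powr (1 / a)" for x
    using assms(1) by (simp add: inv_into_abs_powr tail_prob_nonneg)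
  have le: "?g x \<le> C powr (1 / a)" if "x \<ge> 0" for x
  proof (cases "x = 0")
    case False
    with that have "x > 0" by simp
    have "tail_prob M X x powr (1 / a) \<le> (C / x powr (a * b)) powr (1 / a)"
      using tail[OF \<open>x > 0\<close>] assms(1) by (intro powr_mono2) (auto simp: tail_prob_nonneg)
    also have "\<dots> = C powr (1 / a) / x powr b"
      using assms(1,2) by (simp add: powr_divide powr_powr)
    finally show ?thesis
      unfolding g using \<open>x > 0\<close> by (simp add: field_simps)
  qed (simp add: g)
  then have "bdd_above (?g ` {0..})"
    by (intro bdd_aboveI2[where M = "C powr (1 / a)"]) simp
  with X show "X \<in> D_space M (\<lambda>x. \<bar>x\<bar> powr b) (\<lambda>x. \<bar>x\<bar> powr a)"
    by (simp add: D_space_def)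
  have "(SUP x\<in>{0<..}. ?g x) \<le> C powr (1 / a)"
    by (rule cSUP_least) (use le in auto)
  then have "D_prenorm M (\<lambda>x. \<bar>x\<bar> powr b) (\<lambda>x. \<bar>x\<bar> powr a) X \<le> sqrt (C powr (1 / a))"
    by (simp add: D_prenorm_def)
  also have "\<dots> = C powr (1 / (2 * a))"
    by (simp add: powr_powr field_simps flip: powr_half_sqrt)
  finally show "D_prenorm M (\<lambda>x. \<bar>x\<bar> powr b) (\<lambda>x. \<bar>x\<bar> powr a) X \<le> C powr (1 / (2 * a))" .
qed

section \<open>Distributing the level over the summands\<close>

text \<open>Tail bounds at positive levels reach level zero because the variable is nonzero only if its
  absolute value exceeds some \<open>1 / (n + 1)\<close>, and countably many null events have a null union.\<close>

lemma (in prob_space) prob_abs_pos_eq_0: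
  fixes X :: "'a \<Rightarrow> real"
  assumes [measurable]: "X \<in> borel_measurable M"
    and zero: "\<And>x. x > 0 \<Longrightarrow> prob {\<omega> \<in> space M. \<bar>X \<omega>\<bar> > x} = 0"
  shows "prob {\<omega> \<in> space M. \<bar>X \<omega>\<bar> > 0} = 0"
proof -
  have "AE \<omega> in M. \<forall>n. \<bar>X \<omega>\<bar> \<le> 1 / real (Suc n)"
    unfolding AE_all_countable
  proof
    fix n
    have "AE \<omega> in M. \<not> \<bar>X \<omega>\<bar> > 1 / real (Suc n)"
      using zero[of "1 / real (Suc n)"] by (subst prob_Collect_eq_0[symmetric]) auto
    then show "AE \<omega> in M. \<bar>X \<omega>\<bar> \<le> 1 / real (Suc n)"
      by (simp add: not_less)
  qed
  then have "AE \<omega> in M. \<not> \<bar>X \<omega>\<bar> > 0"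
  proof eventually_elim
    case (elim \<omega>)
    show ?case
    proof
      assume "\<bar>X \<omega>\<bar> > 0"
      then obtain n where "inverse (real (Suc n)) < \<bar>X \<omega>\<bar>"
        using reals_Archimedean by blast
      with elim show False
        by (metis inverse_eq_divide not_less)
    qed
  qed
  then show ?thesis
    by (subst prob_Collect_eq_0) auto
qed

text \<open>The union bound with the levels \<open>x * q\<^sub>k / Q\<close>. Since the \<open>q\<^sub>k\<close> sum to \<open>Q\<close>, these levels sum
  to at most \<open>x\<close>, so a partial sum of absolute values can exceed \<open>x\<close> only if some summand exceeds
  its own level. The hypothesis bounds the probability of that by \<open>q\<^sub>k * Q powr p / x powr p\<close>. A
  summand with \<open>q\<^sub>k = 0\<close> vanishes almost surely and gets level zero.\<close>

lemma (in prob_space) prob_abs_partial_sums_exceed: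
  fixes X :: "nat \<Rightarrow> 'a \<Rightarrow> real"
  assumes [measurable]: "\<And>k. X k \<in> borel_measurable M"
    and "p > 0" and q: "\<And>k. q k \<ge> 0" and "q sums Q"
    and tail: "\<And>k x. x > 0 \<Longrightarrow> prob {\<omega> \<in> space M. \<bar>X k \<omega>\<bar> > x} \<le> q k powr (p + 1) / x powr p"
    and "x > 0"
  shows "prob {\<omega> \<in> space M. \<exists>n. (\<Sum>k<n. \<bar>X k \<omega>\<bar>) > x} \<le> Q powr (p + 1) / x powr p"
proof -
  define A where "A k = {\<omega> \<in> space M. \<bar>X k \<omega>\<bar> > x * q k / Q}" for k
  have [measurable]: "A k \<in> sets M" for k
    unfolding A_def by measurable
  have part: "(\<Sum>k<n. q k) \<le> Q" for n
    using sum_le_suminf[of q "{..<n}"] q \<open>q sums Q\<close> by (auto simp: sums_iff)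
  have qQ: "q k \<le> Q" for k
    using part[of "Suc k"] sum_nonneg[of "{..<k}" q] q by simp
  have Q: "Q \<ge> 0"
    using part[of 0] by simp
  have A: "prob (A k) \<le> q k * (Q powr p / x powr p)" for k
  proof (cases "q k = 0")
    case True
    have "prob {\<omega> \<in> space M. \<bar>X k \<omega>\<bar> > y} = 0" if "y > 0" for y
      using tail[OF that, of k] True \<open>p > 0\<close> by (intro antisym) auto
    then show ?thesis
      using prob_abs_pos_eq_0[of "X k"] True by (simp add: A_def)
  next
    case False
    then have "q k > 0" "Q > 0"
      using q[of k] qQ[of k] by linarith+
    then have "prob (A k) \<le> q k powr (p + 1) / (x * q k / Q) powr p"
      unfolding A_def using \<open>x > 0\<close> by (intro tail) auto
    also have "\<dots> = q k * (Q powr p / x powr p)"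
      using \<open>q k > 0\<close> \<open>Q > 0\<close> \<open>x > 0\<close>
      by (simp add: powr_add powr_divide powr_mult field_simps)
    finally show ?thesis .
  qed
  have bound: "(\<lambda>k. q k * (Q powr p / x powr p)) sums (Q * (Q powr p / x powr p))"
    using \<open>q sums Q\<close> by (rule sums_mult2)
  have sumA: "summable (\<lambda>k. prob (A k))"
    by (rule summable_comparison_test'[OF sums_summable[OF bound]]) (use A in simp)
  have "{\<omega> \<in> space M. \<exists>n. (\<Sum>k<n. \<bar>X k \<omega>\<bar>) > x} \<subseteq> (\<Union>k. A k)"
  proof (rule subsetI, rule ccontr)
    fix \<omega> assume *: "\<omega> \<in> {\<omega> \<in> space M. \<exists>n. (\<Sum>k<n. \<bar>X k \<omega>\<bar>) > x}" "\<omega> \<notin> (\<Union>k. A k)"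
    then obtain n where n: "(\<Sum>k<n. \<bar>X k \<omega>\<bar>) > x" by blast
    have "(\<Sum>k<n. \<bar>X k \<omega>\<bar>) \<le> (\<Sum>k<n. x * q k / Q)"
      using * by (intro sum_mono) (auto simp: A_def not_less)
    also have "\<dots> = x * ((\<Sum>k<n. q k) / Q)"
      by (simp add: sum_distrib_left sum_divide_distrib)
    also have "\<dots> \<le> x * 1"
      using part[of n] Q \<open>x > 0\<close> by (intro mult_left_mono) (auto simp: divide_le_eq_1)
    finally show False
      using n by simp
  qed
  then have "prob {\<omega> \<in> space M. \<exists>n. (\<Sum>k<n. \<bar>X k \<omega>\<bar>) > x} \<le> prob (\<Union>k. A k)"
    by (intro finite_measure_mono) auto
  also have "\<dots> \<le> (\<Sum>k. prob (A k))"
    by (rule finite_measure_subadditive_countably) (use sumA in auto)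
  also have "\<dots> \<le> Q * (Q powr p / x powr p)"
    using suminf_le[OF A sumA sums_summable[OF bound]] sums_unique[OF bound] by simp
  also have "\<dots> = Q powr (p + 1) / x powr p"
    using Q by (simp add: powr_add)
  finally show ?thesis .
qed

section \<open>Convergence of the series\<close>

lemma tendsto_powr_divide_at_top:
  fixes C p :: real
  assumes "p > 0"
  shows "((\<lambda>x. C / x powr p) \<longlongrightarrow> 0) at_top"
  using tendsto_mult_right_zero[OF tendsto_neg_powr[OF _ filterlim_ident], of "-p" C] assms
  by (simp add: powr_minus divide_inverse)

text \<open>If the series of absolute values diverges at a point, its partial sums exceed every level
  there; the probability of exceeding the level \<open>x\<close> tends to zero as \<open>x\<close> grows.\<close>

lemma (in prob_space) AE_summable_abs:
  fixes X :: "nat \<Rightarrow> 'a \<Rightarrow> real"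
  assumes [measurable]: "\<And>k. X k \<in> borel_measurable M"
    and "p > 0" and q: "\<And>k. q k \<ge> 0" and "q sums Q"
    and tail: "\<And>k x. x > 0 \<Longrightarrow> prob {\<omega> \<in> space M. \<bar>X k \<omega>\<bar> > x} \<le> q k powr (p + 1) / x powr p"
  shows "AE \<omega> in M. summable (\<lambda>k. \<bar>X k \<omega>\<bar>)"
proof -
  let ?N = "{\<omega> \<in> space M. \<not> summable (\<lambda>k. \<bar>X k \<omega>\<bar>)}"
  have [measurable]: "Measurable.pred M (\<lambda>\<omega>. summable (\<lambda>k. \<bar>X k \<omega>\<bar>))"
    unfolding summable_iff_convergent Cauchy_convergent_iff[symmetric] pred_def
    by (rule sets_Collect_Cauchy) measurable
  have "prob ?N \<le> Q powr (p + 1) / x powr p" if "x > 0" for x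
  proof -
    have "summable (\<lambda>k. \<bar>X k \<omega>\<bar>)" if "\<And>n. (\<Sum>k<n. \<bar>X k \<omega>\<bar>) \<le> x" for \<omega>
    proof (rule bounded_imp_summable)
      show "(\<Sum>k\<le>n. \<bar>X k \<omega>\<bar>) \<le> x" for n
        using that[of "Suc n"] by (simp only: lessThan_Suc_atMost)
    qed simp
    then have "?N \<subseteq> {\<omega> \<in> space M. \<exists>n. (\<Sum>k<n. \<bar>X k \<omega>\<bar>) > x}"
      by (auto simp flip: not_le)
    then have "prob ?N \<le> prob {\<omega> \<in> space M. \<exists>n. (\<Sum>k<n. \<bar>X k \<omega>\<bar>) > x}"
      by (intro finite_measure_mono) auto
    also have "\<dots> \<le> Q powr (p + 1) / x powr p"
      by (rule prob_abs_partial_sums_exceed[where q = q]) (use assms that in auto)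
    finally show ?thesis .
  qed
  then have "eventually (\<lambda>x. prob ?N \<le> Q powr (p + 1) / x powr p) at_top"
    by (intro eventually_mono[OF eventually_gt_at_top[of 0]]) auto
  then have "prob ?N \<le> 0"
    using tendsto_lowerbound[OF tendsto_powr_divide_at_top[OF \<open>p > 0\<close>]] by simp
  then have "prob ?N = 0"
    by (simp add: measure_le_0_iff)
  then show ?thesis
    by (subst (asm) prob_Collect_eq_0) auto
qed

text \<open>The limit is the pointwise sum. Its distance to the \<open>n\<close>-th partial sum is controlled by the
  estimate for the shifted series, whose total \<open>Q - (\<Sum>k<n. q k)\<close> tends to zero.\<close>

lemma (in prob_space) tendsto_in_prob_partial_sums:
  fixes X :: "nat \<Rightarrow> 'a \<Rightarrow> real"
  assumes [measurable]: "\<And>k. X k \<in> borel_measurable M"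
    and "p > 0" and q: "\<And>k. q k \<ge> 0" and "q sums Q"
    and tail: "\<And>k x. x > 0 \<Longrightarrow> prob {\<omega> \<in> space M. \<bar>X k \<omega>\<bar> > x} \<le> q k powr (p + 1) / x powr p"
  shows "tendsto_in_prob M (\<lambda>n \<omega>. \<Sum>k<n. X k \<omega>) (\<lambda>\<omega>. \<Sum>k. X k \<omega>)"
proof -
  let ?S = "\<lambda>\<omega>. \<Sum>k. X k \<omega>"
  have [measurable]: "?S \<in> borel_measurable M"
    by measurable
  have "(\<lambda>n. prob {\<omega> \<in> space M. \<bar>(\<Sum>k<n. X k \<omega>) - ?S \<omega>\<bar> > \<epsilon>}) \<longlonglongrightarrow> 0" if "\<epsilon> > 0" for \<epsilon>
  proof (rule tendsto_sandwich[OF _ _ tendsto_const])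
    let ?R = "\<lambda>n. Q - (\<Sum>k<n. q k)"
    have "prob {\<omega> \<in> space M. \<bar>(\<Sum>k<n. X k \<omega>) - ?S \<omega>\<bar> > \<epsilon>} \<le> ?R n powr (p + 1) / \<epsilon> powr p" for n
    proof -
      have "prob {\<omega> \<in> space M. \<bar>(\<Sum>k<n. X k \<omega>) - ?S \<omega>\<bar> > \<epsilon>}
          \<le> prob {\<omega> \<in> space M. \<exists>m. (\<Sum>k<m. \<bar>X (k + n) \<omega>\<bar>) > \<epsilon>}"
      proof (rule finite_measure_mono_AE)
        have "AE \<omega> in M. summable (\<lambda>k. \<bar>X k \<omega>\<bar>)"
          by (rule AE_summable_abs[where q = q]) (use assms in auto)
        then show "AE \<omega> in M. \<omega> \<in> {\<omega> \<in> space M. \<bar>(\<Sum>k<n. X k \<omega>) - ?S \<omega>\<bar> > \<epsilon>}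
            \<longrightarrow> \<omega> \<in> {\<omega> \<in> space M. \<exists>m. (\<Sum>k<m. \<bar>X (k + n) \<omega>\<bar>) > \<epsilon>}"
        proof eventually_elim
          case (elim \<omega>)
          have abs': "summable (\<lambda>k. \<bar>X (k + n) \<omega>\<bar>)"
            using elim by (rule summable_ignore_initial_segment)
          have "\<bar>(\<Sum>k<n. X k \<omega>) - ?S \<omega>\<bar> = \<bar>\<Sum>k. X (k + n) \<omega>\<bar>"
            using suminf_split_initial_segment[OF summable_rabs_cancel[OF elim], of n] by simp
          also have "\<dots> \<le> (\<Sum>k. \<bar>X (k + n) \<omega>\<bar>)"
            by (rule summable_rabs[OF abs'])
          finally have le: "\<bar>(\<Sum>k<n. X k \<omega>) - ?S \<omega>\<bar> \<le> (\<Sum>k. \<bar>X (k + n) \<omega>\<bar>)" .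
          have "\<exists>m. (\<Sum>k<m. \<bar>X (k + n) \<omega>\<bar>) > \<epsilon>" if "\<bar>(\<Sum>k<n. X k \<omega>) - ?S \<omega>\<bar> > \<epsilon>"
          proof (rule ccontr)
            assume "\<not> ?thesis"
            then have "(\<Sum>k. \<bar>X (k + n) \<omega>\<bar>) \<le> \<epsilon>"
              using suminf_le_const[OF abs'] by (simp add: not_less)
            with le that show False by simp
          qed
          then show ?case by simp
        qed
      qed auto
      also have "\<dots> \<le> ?R n powr (p + 1) / \<epsilon> powr p"
      proof (rule prob_abs_partial_sums_exceed[where q = "\<lambda>k. q (k + n)"])
        show "(\<lambda>k. q (k + n)) sums ?R n"
          using \<open>q sums Q\<close> by (rule sums_split_initial_segment)
      qed (use assms that in auto)
      finally show ?thesis .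
    qed
    then show "eventually (\<lambda>n. prob {\<omega> \<in> space M. \<bar>(\<Sum>k<n. X k \<omega>) - ?S \<omega>\<bar> > \<epsilon>}
        \<le> ?R n powr (p + 1) / \<epsilon> powr p) sequentially"
      by simp
    have "?R \<longlonglongrightarrow> Q - Q"
      using \<open>q sums Q\<close> unfolding sums_def by (intro tendsto_intros)
    moreover have "?R n \<ge> 0" for n
      using sum_le_suminf[of q "{..<n}"] q \<open>q sums Q\<close> by (auto simp: sums_iff)
    ultimately have "(\<lambda>n. ?R n powr (p + 1)) \<longlonglongrightarrow> 0 powr (p + 1)"
      using \<open>p > 0\<close> by (intro tendsto_powr2) auto
    then show "(\<lambda>n. ?R n powr (p + 1) / \<epsilon> powr p) \<longlonglongrightarrow> 0"
      using tendsto_divide[OF _ tendsto_const, of "\<lambda>n. ?R n powr (p + 1)" 0 sequentially "\<epsilon> powr p"]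
        \<open>\<epsilon> > 0\<close> by simp
  qed auto
  then show ?thesis
    by (auto simp: tendsto_in_prob_def)
qed

section \<open>Tail estimates under limits in probability\<close>

text \<open>If \<open>Y\<close> exceeds \<open>y\<close>, then \<open>X\<^sub>n\<close> exceeds a given smaller level \<open>z\<close> unless it differs from \<open>Y\<close>
  by more than \<open>y - z\<close>, an event whose probability tends to zero. This yields the bound \<open>f z\<close>, and
  left-continuity of \<open>f\<close> at \<open>y\<close> turns it into \<open>f y\<close>.\<close>

lemma (in prob_space) prob_abs_gt_le_of_tendsto_in_prob:
  fixes X :: "nat \<Rightarrow> 'a \<Rightarrow> real" and f :: "real \<Rightarrow> real"
  assumes lim: "tendsto_in_prob M X Y"
    and bound: "\<And>n z. z > 0 \<Longrightarrow> prob {\<omega> \<in> space M. \<bar>X n \<omega>\<bar> > z} \<le> f z"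
    and "y > 0" and cont: "(f \<longlongrightarrow> f y) (at_left y)"
  shows "prob {\<omega> \<in> space M. \<bar>Y \<omega>\<bar> > y} \<le> f y"
proof -
  have [measurable]: "X n \<in> borel_measurable M" "Y \<in> borel_measurable M" for n
    using lim by (auto simp: tendsto_in_prob_def)
  have "prob {\<omega> \<in> space M. \<bar>Y \<omega>\<bar> > y} \<le> f z" if z: "0 < z" "z < y" for z
  proof -
    define e where "e = y - z"
    have "e > 0" using z by (simp add: e_def)
    have "prob {\<omega> \<in> space M. \<bar>Y \<omega>\<bar> > y}
        \<le> f z + prob {\<omega> \<in> space M. \<bar>X n \<omega> - Y \<omega>\<bar> > e}" for n
    proof -
      have "prob {\<omega> \<in> space M. \<bar>Y \<omega>\<bar> > y}
          \<le> prob ({\<omega> \<in> space M. \<bar>X n \<omega>\<bar> > z} \<union> {\<omega> \<in> space M. \<bar>X n \<omega> - Y \<omega>\<bar> > e})"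
      proof (intro finite_measure_mono subsetI)
        fix \<omega> assume "\<omega> \<in> {\<omega> \<in> space M. \<bar>Y \<omega>\<bar> > y}"
        moreover have "\<bar>Y \<omega>\<bar> \<le> \<bar>X n \<omega>\<bar> + \<bar>X n \<omega> - Y \<omega>\<bar>" by linarith
        ultimately show "\<omega> \<in> {\<omega> \<in> space M. \<bar>X n \<omega>\<bar> > z} \<union> {\<omega> \<in> space M. \<bar>X n \<omega> - Y \<omega>\<bar> > e}"
          using z by (auto simp: e_def)
      qed auto
      also have "\<dots> \<le> prob {\<omega> \<in> space M. \<bar>X n \<omega>\<bar> > z} + prob {\<omega> \<in> space M. \<bar>X n \<omega> - Y \<omega>\<bar> > e}"
        by (rule measure_Un_le) auto
      also have "\<dots> \<le> f z + prob {\<omega> \<in> space M. \<bar>X n \<omega> - Y \<omega>\<bar> > e}"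
        using bound[of z n] z by simp
      finally show ?thesis .
    qed
    moreover have "(\<lambda>n. f z + prob {\<omega> \<in> space M. \<bar>X n \<omega> - Y \<omega>\<bar> > e}) \<longlonglongrightarrow> f z + 0"
      using lim \<open>e > 0\<close> by (intro tendsto_intros) (auto simp: tendsto_in_prob_def)
    ultimately show ?thesis
      using LIMSEQ_le_const[of "\<lambda>n. f z + prob {\<omega> \<in> space M. \<bar>X n \<omega> - Y \<omega>\<bar> > e}" "f z"] by auto
  qed
  then have "eventually (\<lambda>z. prob {\<omega> \<in> space M. \<bar>Y \<omega>\<bar> > y} \<le> f z) (at_left y)"
    using \<open>y > 0\<close> by (auto simp: eventually_at_left_real intro!: eventually_at_leftI[of 0])
  then show ?thesis
    using tendsto_lowerbound[OF cont] by simp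
qed

section \<open>Sums in power-weighted spaces\<close>

theorem theorem6p4:
  fixes M :: "'w measure" and V W :: "real \<Rightarrow> real" and a b \<mu> :: real
    and \<xi> :: "nat \<Rightarrow> 'w \<Rightarrow> real"
  assumes "prob_space M"
    and "a > 0" and "b > 0"
    and "W = (\<lambda>x. \<bar>x\<bar> powr a)" and "V = (\<lambda>x. \<bar>x\<bar> powr b)"
    and "\<And>k. k \<ge> 1 \<Longrightarrow> \<xi> k \<in> D_space M V W"
    and "(\<lambda>k. D_prenorm M V W (\<xi> (Suc k)) powr (2 * a / (a * b + 1))) sums \<mu>"
  shows "(\<exists>S. sums_in_prob M \<xi> S) \<and>
    (\<forall>S. sums_in_prob M \<xi> S \<longrightarrow>
       (\<forall>x\<ge>\<mu>. measure M {\<omega> \<in> space M. \<bar>S \<omega>\<bar> > x} \<le> 1 / x powr (a * b) * \<mu> powr (a * b + 1)) \<and>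
       S \<in> D_space M V W \<and>
       D_prenorm M V W S \<le> \<mu> powr ((a * b + 1) / (2 * a)))"
proof -
  interpret prob_space M by fact
  define p where "p = a * b"
  have "p > 0" using assms(2,3) by (simp add: p_def)
  define q where "q k = D_prenorm M V W (\<xi> (Suc k)) powr (2 * a / (p + 1))" for k
  define X where "X k = \<xi> (Suc k)" for k
  have D: "X k \<in> D_space M (\<lambda>x. \<bar>x\<bar> powr b) (\<lambda>x. \<bar>x\<bar> powr a)" for k
    using assms(6)[of "Suc k"] by (simp add: X_def assms(4,5))
  then have X[measurable]: "X k \<in> borel_measurable M" for k
    by (simp add: D_space_def)
  have q: "q k \<ge> 0" for k
    by (simp add: q_def)
  have sums: "q sums \<mu>"
    using assms(7) by (simp add: q_def[abs_def] p_def)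
  then have \<mu>: "\<mu> \<ge> 0"
    using q by (metis sums_le sums_zero)
  have tail: "prob {\<omega> \<in> space M. \<bar>X k \<omega>\<bar> > x} \<le> q k powr (p + 1) / x powr p" if "x > 0" for k x
    using tail_prob_le_of_D_space[OF assms(2) D that, of k] \<open>p > 0\<close>
    by (simp add: q_def powr_powr p_def tail_prob_def X_def assms(4,5))
  have partial: "(\<Sum>k=1..n. \<xi> k \<omega>) = (\<Sum>k<n. X k \<omega>)" for n \<omega>
    unfolding X_def by (rule sum.reindex_bij_witness[where i = Suc and j = "\<lambda>k. k - 1"]) auto
  have "sums_in_prob M \<xi> (\<lambda>\<omega>. \<Sum>k. X k \<omega>)"
    unfolding sums_in_prob_def partial
    by (rule tendsto_in_prob_partial_sums[OF X \<open>p > 0\<close> q sums tail])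
  moreover have "(\<forall>x\<ge>\<mu>. prob {\<omega> \<in> space M. \<bar>S \<omega>\<bar> > x} \<le> 1 / x powr (a * b) * \<mu> powr (a * b + 1)) \<and>
      S \<in> D_space M V W \<and> D_prenorm M V W S \<le> \<mu> powr ((a * b + 1) / (2 * a))"
    if S: "sums_in_prob M \<xi> S" for S
  proof -
    have lim: "tendsto_in_prob M (\<lambda>n \<omega>. \<Sum>k<n. X k \<omega>) S"
      using S unfolding sums_in_prob_def partial .
    then have [measurable]: "S \<in> borel_measurable M"
      by (simp add: tendsto_in_prob_def)
    have Stail: "prob {\<omega> \<in> space M. \<bar>S \<omega>\<bar> > x} \<le> \<mu> powr (p + 1) / x powr p" if "x > 0" for x
    proof (rule prob_abs_gt_le_of_tendsto_in_prob[OF lim _ that])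
      fix n and z :: real assume "z > 0"
      have "prob {\<omega> \<in> space M. \<bar>\<Sum>k<n. X k \<omega>\<bar> > z}
          \<le> prob {\<omega> \<in> space M. \<exists>n. (\<Sum>k<n. \<bar>X k \<omega>\<bar>) > z}"
        by (intro finite_measure_mono) (auto intro: less_le_trans[OF _ sum_abs])
      also have "\<dots> \<le> \<mu> powr (p + 1) / z powr p"
        by (rule prob_abs_partial_sums_exceed[OF X \<open>p > 0\<close> q sums tail \<open>z > 0\<close>])
      finally show "prob {\<omega> \<in> space M. \<bar>\<Sum>k<n. X k \<omega>\<bar> > z} \<le> \<mu> powr (p + 1) / z powr p" .
    next
      show "((\<lambda>z. \<mu> powr (p + 1) / z powr p) \<longlongrightarrow> \<mu> powr (p + 1) / x powr p) (at_left x)"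
        using that by (intro tendsto_intros) auto
    qed
    have "prob {\<omega> \<in> space M. \<bar>S \<omega>\<bar> > x} \<le> 1 / x powr p * \<mu> powr (p + 1)" if "x \<ge> \<mu>" for x
    proof (cases "x > 0")
      case True
      then show ?thesis using Stail[OF True] by simp
    next
      \<comment> \<open>Here \<open>x = \<mu> = 0\<close>, so that \<open>S\<close> vanishes almost surely.\<close>
      case False
      with \<mu> that have "x = 0" "\<mu> = 0" by auto
      have "prob {\<omega> \<in> space M. \<bar>S \<omega>\<bar> > y} = 0" if "y > 0" for y
        using Stail[OF that] \<open>\<mu> = 0\<close> \<open>p > 0\<close> by (intro antisym) auto
      then show ?thesis
        using prob_abs_pos_eq_0[of S] \<open>x = 0\<close> by simp
    qed
    moreover note D_space_of_tail_prob_le[OF assms(2), of "\<mu> powr (p + 1)" S M]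
    ultimately show ?thesis
      using Stail by (simp add: assms(4,5) p_def tail_prob_def powr_powr)
  qed
  ultimately show ?thesis
    by blast
qed

end
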